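(* Let $\delta$ be the distance on $\mathbb{B}$ given by $$\delta(w,z)=\sqrt{1-\left|\left\langle \frac{k_w}{\|k_w\|_{H^2(\mathbb{B})}},\frac{k_z}{\|k_z\|_{H^2(\mathbb{B})}}\right\rangle_{H^2(\mathbb{B})}\right|^2},$$ where $k_w(q)=\sum_{n\ge0}q^n\overline w^n$ is the reproducing kernel of $H^2(\mathbb{B})$. Then for any $w,z\in\mathbb{B}$, $\delta(w,z)$ coincides both with the modulus of the value at $z$ of the regular Möbius transformation $M_w$ and with the modulus of the value at $w$ of the regular Möbius transformation $M_z$, namely $$\delta(w,z)=\left|(1-q\overline z)^{-*}*(q-z)\right|_{|_{q=w}}=\left|(1-q\overline w)^{-*}*(q-w)\right|_{|_{q=z}}.$$
   Context: $\mathbb{H}$ is the skew-field of quaternions and $\mathbb{B}=\{q\in\mathbb{H}:|q|<1\}$. The quaternionic Hardy space $H^2(\mathbb{B})$ is the space of power series $f(q)=\sum_{n\ge0}q^na_n$, $a_n\in\mathbb{H}$, with $\|f\|_{H^2(\mathbb{B})}^2=\sum|a_n|^2<\infty$, and inner product $\langle\sum q^na_n,\sum q^nb_n\rangle_{H^2(\mathbb{B})}=\sum\overline{b_n}a_n$; one has $f(w)=\langle f,k_w\rangle_{H^2(\mathbb{B})}$. The $*$-product of power series in $q$ is $(\sum q^na_n)*(\sum q^nb_n)=\sum q^n\sum_{k=0}^na_kb_{n-k}$, and $f^{-*}$ is the inverse of $f$ for $*$, so that $(1-q\overline a)^{-*}=\sum_{n\ge0}q^n\overline a^n$. For $a\in\mathbb{B}$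 the regular Möbius transformation is $M_a(q)=(1-q\overline a)^{-*}*(q-a)$; the products are computed as $*$-products of series in $q$ and then evaluated. *)

theory Defs
  imports "HOL-Analysis.Analysis" "HOL-Computational_Algebra.Formal_Power_Series"
begin

section \<open>The skew-field of quaternions\<close>

codatatype quat = Quat (qre: real) (qim1: real) (qim2: real) (qim3: real)

lemma quat_eq_iff:
  "x = y \<longleftrightarrow> qre x = qre y \<and> qim1 x = qim1 y \<and> qim2 x = qim2 y \<and> qim3 x = qim3 y"
  by (auto intro: quat.expand)

instantiation quat :: ab_group_add
begin

primcorec zero_quat where
  "qre 0 = 0"
| "qim1 0 = 0"
| "qim2 0 = 0"
| "qim3 0 = 0"

primcorec plus_quat where
  "qre (x + y) = qre x + qre y"
| "qim1 (x + y) = qim1 x + qim1 y"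
| "qim2 (x + y) = qim2 x + qim2 y"
| "qim3 (x + y) = qim3 x + qim3 y"

primcorec uminus_quat where
  "qre (- x) = - qre x"
| "qim1 (- x) = - qim1 x"
| "qim2 (- x) = - qim2 x"
| "qim3 (- x) = - qim3 x"

primcorec minus_quat where
  "qre (x - y) = qre x - qre y"
| "qim1 (x - y) = qim1 x - qim1 y"
| "qim2 (x - y) = qim2 x - qim2 y"
| "qim3 (x - y) = qim3 x - qim3 y"

instance
  by standard (simp_all add: quat_eq_iff)

end

instantiation quat :: ring_1
begin

primcorec one_quat where
  "qre 1 = 1"
| "qim1 1 = 0"
| "qim2 1 = 0"
| "qim3 1 = 0"

primcorec times_quat where
  "qre (x * y) = qre x * qre y - qim1 x * qim1 y - qim2 x * qim2 y - qim3 x * qim3 y"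
| "qim1 (x * y) = qre x * qim1 y + qim1 x * qre y + qim2 x * qim3 y - qim3 x * qim2 y"
| "qim2 (x * y) = qre x * qim2 y - qim1 x * qim3 y + qim2 x * qre y + qim3 x * qim1 y"
| "qim3 (x * y) = qre x * qim3 y + qim1 x * qim2 y - qim2 x * qim1 y + qim3 x * qre y"

instance
  by standard (simp_all add: quat_eq_iff algebra_simps)

end

primcorec qcnj :: "quat \<Rightarrow> quat" where
  "qre (qcnj x) = qre x"
| "qim1 (qcnj x) = - qim1 x"
| "qim2 (qcnj x) = - qim2 x"
| "qim3 (qcnj x) = - qim3 x"

instantiation quat :: real_algebra_1
begin

primcorec scaleR_quat where
  "qre (scaleR r x) = r * qre x"
| "qim1 (scaleR r x) = r * qim1 x"
| "qim2 (scaleR r x) = r * qim2 x"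
| "qim3 (scaleR r x) = r * qim3 x"

instance
  by standard (simp_all add: quat_eq_iff algebra_simps)

end

instantiation quat :: real_inner
begin

definition inner_quat :: "quat \<Rightarrow> quat \<Rightarrow> real" where
  "inner_quat x y = qre x * qre y + qim1 x * qim1 y + qim2 x * qim2 y + qim3 x * qim3 y"

definition norm_quat :: "quat \<Rightarrow> real" where
  "norm_quat x = sqrt ((qre x)\<^sup>2 + (qim1 x)\<^sup>2 + (qim2 x)\<^sup>2 + (qim3 x)\<^sup>2)"

definition sgn_quat :: "quat \<Rightarrow> quat" where
  "sgn_quat x = x /\<^sub>R norm x"

definition dist_quat :: "quat \<Rightarrow> quat \<Rightarrow> real" where
  "dist_quat x y = norm (x - y)"

definition uniformity_quat :: "(quat \<times> quat) filter" where
  "uniformity_quat = (INF e\<in>{0 <..}. principal {(x, y). dist x y < e})"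

definition open_quat :: "quat set \<Rightarrow> bool" where
  "open_quat U \<longleftrightarrow> (\<forall>x\<in>U. eventually (\<lambda>(x', y). x' = x \<longrightarrow> y \<in> U) uniformity)"

instance
proof
  fix x y z :: quat and r :: real and U :: "quat set"
  show "dist x y = norm (x - y)" by (rule dist_quat_def)
  show "sgn x = x /\<^sub>R norm x" by (rule sgn_quat_def)
  show "uniformity = (INF e\<in>{0 <..}. principal {(x::quat, y). dist x y < e})"
    by (rule uniformity_quat_def)
  show "open U \<longleftrightarrow> (\<forall>x\<in>U. eventually (\<lambda>(x', y). x' = x \<longrightarrow> y \<in> U) uniformity)"
    by (rule open_quat_def)
  show "x \<bullet> y = y \<bullet> x"
    by (simp add: inner_quat_def algebra_simps)
  show "(x + y) \<bullet> z = x \<bullet> z + y \<bullet> z"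
    by (simp add: inner_quat_def algebra_simps)
  show "(r *\<^sub>R x) \<bullet> y = r * (x \<bullet> y)"
    by (simp add: inner_quat_def algebra_simps)
  show "0 \<le> x \<bullet> x"
    by (simp add: inner_quat_def)
  show "x \<bullet> x = 0 \<longleftrightarrow> x = 0"
  proof
    assume "x \<bullet> x = 0"
    then have *: "qre x * qre x + qim1 x * qim1 x + qim2 x * qim2 x + qim3 x * qim3 x = 0"
      by (simp add: inner_quat_def)
    have "0 \<le> qre x * qre x" "0 \<le> qim1 x * qim1 x" "0 \<le> qim2 x * qim2 x" "0 \<le> qim3 x * qim3 x"
      by simp_all
    with * have "qre x * qre x = 0" "qim1 x * qim1 x = 0" "qim2 x * qim2 x = 0" "qim3 x * qim3 x = 0"
      by linarith+
    then show "x = 0" by (simp add: quat_eq_iff)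
  qed (simp add: inner_quat_def)
  show "norm x = sqrt (x \<bullet> x)"
    by (simp add: inner_quat_def norm_quat_def power2_eq_square)
qed

end

lemma norm_quat_square: "(norm x)\<^sup>2 = (qre x)\<^sup>2 + (qim1 x)\<^sup>2 + (qim2 x)\<^sup>2 + (qim3 x)\<^sup>2"
  for x :: quat
  by (simp add: norm_quat_def)

lemma qcnj_mult [simp]: "qcnj (x * y) = qcnj y * qcnj x"
  by (simp add: quat_eq_iff)

lemma qcnj_one [simp]: "qcnj 1 = 1"
  by (simp add: quat_eq_iff)

lemma qcnj_qcnj [simp]: "qcnj (qcnj x) = x"
  by (simp add: quat_eq_iff)

lemma qcnj_power [simp]: "qcnj (x ^ n) = qcnj x ^ n"
  by (induction n) (simp_all add: power_commutes)

lemma norm_qcnj [simp]: "norm (qcnj x) = norm x"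
  by (simp add: norm_quat_def)

lemma quat_mult_cnj: "x * qcnj x = (norm x)\<^sup>2 *\<^sub>R 1" "qcnj x * x = (norm x)\<^sup>2 *\<^sub>R 1"
  by (simp_all add: quat_eq_iff norm_quat_square) (simp_all add: power2_eq_square)

instantiation quat :: real_normed_div_algebra
begin

definition inverse_quat :: "quat \<Rightarrow> quat" where
  "inverse_quat x = qcnj x /\<^sub>R (norm x)\<^sup>2"

definition divide_quat :: "quat \<Rightarrow> quat \<Rightarrow> quat" where
  "divide_quat x y = x * inverse y"

instance
proof
  fix x y :: quat
  show "x \<noteq> 0 \<Longrightarrow> inverse x * x = 1" "x \<noteq> 0 \<Longrightarrow> x * inverse x = 1"
    by (simp_all add: inverse_quat_def quat_mult_cnj)
  show "x div y = x * inverse y" by (rule divide_quat_def)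
  show "inverse (0::quat) = 0" by (simp add: inverse_quat_def)
  have "(norm (x * y))\<^sup>2 = (norm x * norm y)\<^sup>2"
    unfolding power_mult_distrib norm_quat_square
    by (simp add: power2_eq_square algebra_simps)
  then show "norm (x * y) = norm x * norm y"
    by (simp add: power2_eq_iff_nonneg)
qed

end

instantiation quat :: euclidean_space
begin

definition Basis_quat :: "quat set" where
  "Basis_quat = {Quat 1 0 0 0, Quat 0 1 0 0, Quat 0 0 1 0, Quat 0 0 0 1}"

instance
proof
  fix x u v :: quat
  show "(Basis :: quat set) \<noteq> {}" "finite (Basis :: quat set)"
    unfolding Basis_quat_def by (rule insert_not_empty) simp
  show "u \<bullet> v = (if u = v then 1 else 0)" if "u \<in> Basis" "v \<in> Basis"
    using that unfolding Basis_quat_def inner_quat_def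
    by (elim insertE emptyE) simp_all
  show "(\<forall>u\<in>Basis. x \<bullet> u = 0) \<longleftrightarrow> x = 0"
    unfolding Basis_quat_def ball_simps
    by (simp add: inner_quat_def quat_eq_iff[of x])
qed

end


section \<open>Power series with right coefficients and the Hardy space\<close>

text \<open>
  The series \<open>\<Sum>n. q^n * a n\<close> is represented by the formal power series with coefficients
  \<open>a n\<close>.  The product of \<^typ>\<open>quat fps\<close> is then the \<open>*\<close>-product, \<^term>\<open>inverse\<close> on
  \<^typ>\<open>quat fps\<close> is the \<open>*\<close>-inverse, and the variable \<open>q\<close> is \<^term>\<open>fps_X\<close>, which
  commutes with every series.  Evaluation has the coefficients on the right, unlike
  \<^const>\<open>eval_fps\<close>, and is not multiplicative.
\<close>

definition qeval :: "quat fps \<Rightarrow> quat \<Rightarrow> quat" where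
  "qeval f q = (\<Sum>n. q ^ n * fps_nth f n)"

definition hardy_space :: "quat fps set" where
  "hardy_space = {f. summable (\<lambda>n. (norm (fps_nth f n))\<^sup>2)}"

definition hardy_inner :: "quat fps \<Rightarrow> quat fps \<Rightarrow> quat" where
  "hardy_inner f g = (\<Sum>n. qcnj (fps_nth g n) * fps_nth f n)"

definition hardy_norm :: "quat fps \<Rightarrow> real" where
  "hardy_norm f = sqrt (\<Sum>n. (norm (fps_nth f n))\<^sup>2)"

definition hardy_normalize :: "quat fps \<Rightarrow> quat fps" where
  "hardy_normalize f = f * fps_const (of_real (1 / hardy_norm f))"

definition hardy_kernel :: "quat \<Rightarrow> quat fps" where
  "hardy_kernel w = Abs_fps (\<lambda>n. qcnj w ^ n)"

definition hardy_dist :: "quat \<Rightarrow> quat \<Rightarrow> real" where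
  "hardy_dist w z =
     sqrt (1 - (norm (hardy_inner (hardy_normalize (hardy_kernel w))
                                  (hardy_normalize (hardy_kernel z))))\<^sup>2)"

definition regular_moebius :: "quat \<Rightarrow> quat fps" where
  "regular_moebius a = inverse (1 - fps_X * fps_const (qcnj a)) * (fps_X - fps_const a)"

lemma hardy_space_inner_summable:
  assumes "f \<in> hardy_space" "g \<in> hardy_space"
  shows "summable (\<lambda>n. qcnj (fps_nth g n) * fps_nth f n)"
proof (rule summable_comparison_test')
  show "summable (\<lambda>n. (norm (fps_nth g n))\<^sup>2 + (norm (fps_nth f n))\<^sup>2)"
    using assms by (simp add: hardy_space_def summable_add)
  fix n
  have *: "a * b \<le> a\<^sup>2 + b\<^sup>2" if "0 \<le> a" "0 \<le> b" for a b :: real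
    using sum_squares_bound[of a b] mult_nonneg_nonneg[OF that] by linarith
  show "norm (qcnj (fps_nth g n) * fps_nth f n) \<le> (norm (fps_nth g n))\<^sup>2 + (norm (fps_nth f n))\<^sup>2"
    by (simp add: norm_mult *)
qed

lemma hardy_kernel_in_hardy_space:
  assumes "w \<in> ball 0 1"
  shows "hardy_kernel w \<in> hardy_space"
proof -
  have "summable (\<lambda>n. ((norm w)\<^sup>2) ^ n)"
    using assms by (intro summable_geometric) (simp add: abs_square_less_1)
  then show ?thesis
    by (simp add: hardy_space_def hardy_kernel_def norm_power mult.commute flip: power_mult)
qed

lemma hardy_inner_kernel: "hardy_inner f (hardy_kernel w) = qeval f w"
  by (simp add: hardy_inner_def hardy_kernel_def qeval_def)

lemma hardy_inner_self:
  assumes "f \<in> hardy_space"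
  shows "hardy_inner f f = of_real ((hardy_norm f)\<^sup>2)"
proof -
  have s: "summable (\<lambda>n. (norm (fps_nth f n))\<^sup>2)"
    using assms by (simp add: hardy_space_def)
  then have "(hardy_norm f)\<^sup>2 = (\<Sum>n. (norm (fps_nth f n))\<^sup>2)"
    by (simp add: hardy_norm_def suminf_nonneg)
  with suminf_of_real[OF s, where 'a = quat] show ?thesis
    by (simp add: hardy_inner_def quat_mult_cnj of_real_def)
qed

lemma inverse_one_minus_X_const:
  "inverse (1 - fps_X * fps_const a) = Abs_fps (\<lambda>n. a ^ n)" for a :: quat
proof -
  let ?f = "1 - fps_X * fps_const a" and ?g = "Abs_fps (\<lambda>n. a ^ n)"
  have eq: "?f * ?g = 1"
  proof (rule fps_ext)
    show "fps_nth (?f * ?g) n = fps_nth 1 n" for n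
      by (cases n) (simp_all add: left_diff_distrib mult.assoc)
  qed
  have "inverse ?f * ?f = 1"
    by (rule inverse_mult_eq_1) simp
  then have "inverse ?f * (?f * ?g) = ?g"
    by (simp only: mult.assoc[symmetric] mult_1_left)
  then show ?thesis
    by (simp only: eq mult_1_right)
qed

lemma regular_moebius_summable:
  assumes "a \<in> ball 0 1" "q \<in> ball 0 1"
  shows "summable (\<lambda>n. q ^ n * fps_nth (regular_moebius a) n)"
proof (rule summable_comparison_test')
  show "summable (\<lambda>n. 2 * norm q ^ n)"
    using assms(2) by (intro summable_mult summable_geometric) simp
  fix n
  have a: "norm (qcnj a ^ k) \<le> 1" for k
    using assms(1) by (simp add: norm_power power_le_one)
  define b where "b = (if n = 0 then 0 else qcnj a ^ (n - 1))"
  have "norm b \<le> 1"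
    using a by (simp add: b_def)
  moreover have "norm (qcnj a ^ n * a) \<le> 1 * 1"
    unfolding norm_mult using assms(1) by (intro mult_mono a) simp_all
  moreover have "fps_nth (regular_moebius a) n = b - qcnj a ^ n * a"
    unfolding regular_moebius_def inverse_one_minus_X_const right_diff_distrib b_def by simp
  ultimately have "norm (fps_nth (regular_moebius a) n) \<le> 2"
    using norm_triangle_ineq4[of b "qcnj a ^ n * a"] by simp
  then show "norm (q ^ n * fps_nth (regular_moebius a) n) \<le> 2 * norm q ^ n"
    by (simp add: norm_mult norm_power mult.commute[of 2] mult_left_mono)
qed

end

theory Submission
  imports Defs
begin

text \<open>
  Everything reduces to the single quaternion \<open>K = \<langle>k_w, k_z\<rangle> = \<Sum>n. z^n (cnj w)^n\<close>.
  Shifting the summation index gives the twisted geometric identity \<open>K = 1 + z K (cnj w)\<close>,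
  which replaces the closed form \<open>1 / (1 - z (cnj w))\<close> of the commutative case.
  Carrying out the \<open>*\<close>-product gives \<open>M_w(z) = z K - K w\<close>.  Hence
  \<open>|M_w(z)|^2 = (|z|^2 + |w|^2) |K|^2 - 2 Re (z K (cnj w) (cnj K))\<close>, where the cross term is
  \<open>Re ((K - 1) (cnj K)) = |K|^2 - Re K\<close>, and taking norms in \<open>K - 1 = z K (cnj w)\<close>
  eliminates \<open>Re K\<close>.  The outcome is \<open>|M_w(z)|^2 = 1 - (1 - |w|^2) (1 - |z|^2) |K|^2\<close>
  (lemma \<open>norm_moebius_form_square\<close>).

  Since \<open>\<parallel>k_w\<parallel>^2 = 1 / (1 - |w|^2)\<close>, the right-hand side is \<open>\<delta>(w, z)^2\<close>.  The other
  equality follows by exchanging the points: this conjugates \<open>K\<close>, so \<open>\<delta>\<close> is symmetric.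
\<close>

lemma inner_mult_qcnj: "inner (x * qcnj y) u = inner x (u * y)"
  by (simp add: inner_quat_def algebra_simps)

text \<open>
  The twisted geometric identity is used twice: linearly in the cross term of the expanded square, and through norms to
  remove the real part of \<open>K\<close> that the cross term leaves behind.
\<close>

lemma norm_moebius_form_square:
  fixes z w K :: quat
  assumes K: "K = 1 + z * K * qcnj w"
  shows "(norm (z * K - K * w))\<^sup>2 = 1 - (1 - (norm w)\<^sup>2) * (1 - (norm z)\<^sup>2) * (norm K)\<^sup>2"
proof -
  have K1: "z * K * qcnj w = K - 1"
    using K by (metis add_diff_cancel_left')
  \<comment> \<open>Moving \<open>w\<close> across the inner product as its conjugate produces \<open>z * K * qcnj w\<close>.\<close>
  have "inner (z * K) (K * w) = inner (K - 1) K"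
    by (metis K1 inner_mult_qcnj)
  then have cross: "inner (z * K) (K * w) = (norm K)\<^sup>2 - inner 1 K"
    by (simp add: inner_diff_left power2_norm_eq_inner)
  have "(norm (K - 1))\<^sup>2 = (norm z)\<^sup>2 * (norm K)\<^sup>2 * (norm w)\<^sup>2"
    by (simp flip: K1 add: norm_mult power_mult_distrib)
  then have re: "(norm K)\<^sup>2 - 2 * inner 1 K + 1 = (norm z)\<^sup>2 * (norm K)\<^sup>2 * (norm w)\<^sup>2"
    by (simp add: power2_norm_eq_inner inner_diff_left inner_diff_right inner_commute)
      (simp add: inner_quat_def)
  have "(norm (z * K - K * w))\<^sup>2
      = (norm (z * K))\<^sup>2 + (norm (K * w))\<^sup>2 - 2 * inner (z * K) (K * w)"
    by (simp add: power2_norm_eq_inner inner_diff_left inner_diff_right inner_commute)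
  also have "\<dots> = (norm z)\<^sup>2 * (norm K)\<^sup>2 + (norm K)\<^sup>2 * (norm w)\<^sup>2
      - 2 * ((norm K)\<^sup>2 - inner 1 K)"
    by (simp add: cross norm_mult power_mult_distrib)
  finally show ?thesis
    using re by (simp add: algebra_simps)
qed

lemma hardy_inner_kernel_sums:
  assumes "w \<in> ball 0 1" "z \<in> ball 0 1"
  shows "(\<lambda>n. z ^ n * qcnj w ^ n) sums hardy_inner (hardy_kernel w) (hardy_kernel z)"
  using summable_sums[OF hardy_space_inner_summable[OF assms[THEN hardy_kernel_in_hardy_space]]]
  by (simp add: hardy_inner_def hardy_kernel_def)

lemma hardy_inner_kernel_eq:
  assumes "w \<in> ball 0 1" "z \<in> ball 0 1"
  defines "K \<equiv> hardy_inner (hardy_kernel w) (hardy_kernel z)"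
  shows "K = 1 + z * K * qcnj w"
proof -
  have K: "(\<lambda>n. z ^ n * qcnj w ^ n) sums K"
    unfolding K_def using assms(1,2) by (rule hardy_inner_kernel_sums)
  have "(\<lambda>n. z * (z ^ n * qcnj w ^ n) * qcnj w) sums (z * K * qcnj w)"
    by (intro sums_mult sums_mult2 K)
  then have "(\<lambda>n. z ^ Suc n * qcnj w ^ Suc n) sums (z * K * qcnj w)"
    by (simp add: mult.assoc power_commutes)
  from sums_Suc[OF this] have "(\<lambda>n. z ^ n * qcnj w ^ n) sums (1 + z * K * qcnj w)"
    by (simp add: add.commute)
  with K show ?thesis
    by (rule sums_unique2)
qed

text \<open>
  The coefficients of \<open>M_w = (1 - q (cnj w))^{-*} * (q - w)\<close> are those of \<open>k_w\<close> shifted by one,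
  minus those of \<open>k_w\<close> multiplied by \<open>w\<close> on the right.  Evaluation at \<open>z\<close> turns the shift into
  multiplication by \<open>z\<close> on the left, because powers of \<open>z\<close> stand to the left of the coefficients.
\<close>

lemma qeval_regular_moebius:
  assumes "w \<in> ball 0 1" "z \<in> ball 0 1"
  defines "K \<equiv> hardy_inner (hardy_kernel w) (hardy_kernel z)"
  shows "qeval (regular_moebius w) z = z * K - K * w"
proof -
  define b where "b n = (if n = 0 then 0 else qcnj w ^ (n - 1))" for n :: nat
  have coeff: "fps_nth (regular_moebius w) n = b n - qcnj w ^ n * w" for n
    unfolding regular_moebius_def inverse_one_minus_X_const right_diff_distrib b_def by simp
  have K: "(\<lambda>n. z ^ n * qcnj w ^ n) sums K"
    unfolding K_def using assms(1,2) by (rule hardy_inner_kernel_sums)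
  have "(\<lambda>n. z ^ Suc n * b (Suc n)) sums (z * K)"
    using sums_mult[OF K, of z] by (simp add: b_def mult.assoc)
  from sums_Suc[OF this] have "(\<lambda>n. z ^ n * b n) sums (z * K)"
    by (simp add: b_def)
  from sums_diff[OF this sums_mult2[OF K, of w]]
  have "(\<lambda>n. z ^ n * fps_nth (regular_moebius w) n) sums (z * K - K * w)"
    by (simp add: coeff right_diff_distrib mult.assoc)
  then show ?thesis
    by (simp add: qeval_def sums_iff)
qed

lemma hardy_norm_kernel_square:
  assumes "w \<in> ball 0 1"
  shows "(hardy_norm (hardy_kernel w))\<^sup>2 = 1 / (1 - (norm w)\<^sup>2)"
proof -
  have "(\<lambda>n. ((norm w)\<^sup>2) ^ n) sums (1 / (1 - (norm w)\<^sup>2))"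
    using assms by (intro geometric_sums) (simp add: abs_square_less_1)
  moreover have "(norm (fps_nth (hardy_kernel w) n))\<^sup>2 = ((norm w)\<^sup>2) ^ n" for n
    by (simp add: hardy_kernel_def norm_power mult.commute flip: power_mult)
  ultimately have "(\<Sum>n. (norm (fps_nth (hardy_kernel w) n))\<^sup>2) = 1 / (1 - (norm w)\<^sup>2)"
    by (simp add: sums_iff)
  moreover have "(norm w)\<^sup>2 < 1"
    using assms by (simp add: abs_square_less_1)
  ultimately show ?thesis
    by (simp add: hardy_norm_def)
qed

lemma hardy_inner_normalize:
  assumes "f \<in> hardy_space" "g \<in> hardy_space"
  shows "hardy_inner (hardy_normalize f) (hardy_normalize g)
    = hardy_inner f g /\<^sub>R (hardy_norm f * hardy_norm g)"
proof -
  define c d where "c = 1 / hardy_norm f" and "d = 1 / hardy_norm g"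
  have "qcnj (fps_nth (hardy_normalize g) n) * fps_nth (hardy_normalize f) n
      = (c * d) *\<^sub>R (qcnj (fps_nth g n) * fps_nth f n)" for n
    by (simp add: hardy_normalize_def c_def d_def quat_eq_iff of_real_def algebra_simps)
  then show ?thesis
    using suminf_scaleR_right[OF hardy_space_inner_summable[OF assms], of "c * d"]
    by (simp add: hardy_inner_def c_def d_def divide_inverse mult.commute)
qed

lemma hardy_dist_eq:
  assumes "w \<in> ball 0 1" "z \<in> ball 0 1"
  shows "hardy_dist w z = sqrt (1 - (1 - (norm w)\<^sup>2) * (1 - (norm z)\<^sup>2)
    * (norm (hardy_inner (hardy_kernel w) (hardy_kernel z)))\<^sup>2)"
proof -
  note mem = assms[THEN hardy_kernel_in_hardy_space]
  show ?thesis
    unfolding hardy_dist_def hardy_inner_normalize[OF mem]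
    by (simp add: power_mult_distrib power_divide power_inverse norm_mult divide_inverse
        hardy_norm_kernel_square[OF assms(1)] hardy_norm_kernel_square[OF assms(2)] mult_ac)
qed

lemma hardy_dist_eq_norm_moebius:
  assumes "w \<in> ball 0 1" "z \<in> ball 0 1"
  shows "hardy_dist w z = norm (qeval (regular_moebius w) z)"
  using norm_moebius_form_square[OF hardy_inner_kernel_eq[OF assms]]
  by (simp add: hardy_dist_eq[OF assms] qeval_regular_moebius[OF assms] real_sqrt_unique)

lemma qcnj_hardy_inner:
  assumes "f \<in> hardy_space" "g \<in> hardy_space"
  shows "qcnj (hardy_inner f g) = hardy_inner g f"
proof -
  have "bounded_linear qcnj"
    by (intro bounded_linear_intro[where K = 1]) (simp_all add: quat_eq_iff)
  from bounded_linear.suminf[OF this hardy_space_inner_summable[OF assms]]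
  show ?thesis
    by (simp add: hardy_inner_def)
qed

lemma hardy_dist_commute:
  assumes "w \<in> ball 0 1" "z \<in> ball 0 1"
  shows "hardy_dist w z = hardy_dist z w"
proof -
  have "norm (hardy_inner (hardy_kernel w) (hardy_kernel z))
      = norm (hardy_inner (hardy_kernel z) (hardy_kernel w))"
    using assms by (metis norm_qcnj qcnj_hardy_inner hardy_kernel_in_hardy_space)
  then show ?thesis
    using assms by (simp add: hardy_dist_eq mult_ac)
qed

theorem proposition4p2:
  fixes w z :: quat
  assumes "w \<in> ball 0 1" and "z \<in> ball 0 1"
  shows "hardy_dist w z = norm (qeval (regular_moebius z) w) \<and>
         hardy_dist w z = norm (qeval (regular_moebius w) z)"
  using hardy_dist_eq_norm_moebius[OF assms] hardy_dist_eq_norm_moebius[OF assms(2,1)]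
    hardy_dist_commute[OF assms] by simp

end
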